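(* Let $G$ be a finite group and let $\sigma,\tau:\mathbb{Z}G\to\mathbb{Z}G$ be $\mathbb{Z}$-linear extensions of group homomorphisms $G\to G$ such that $\sigma$ and $\tau$ fix the center $\mathcal{Z}(\mathbb{Z}G)$ elementwise. Then every $(\sigma,\tau)$-derivation of $\mathbb{Z}G$ is $(\sigma,\tau)$-inner.
   Context: $\mathbb{Z}G$ is the integral group ring of $G$. For ring endomorphisms $\sigma,\tau$ of $\mathbb{Z}G$ (not necessarily distinct), a $(\sigma,\tau)$-derivation of $\mathbb{Z}G$ is a $\mathbb{Z}$-linear map $\delta:\mathbb{Z}G\to\mathbb{Z}G$ satisfying $\delta(ab)=\delta(a)\tau(b)+\sigma(a)\delta(b)$ for all $a,b\in\mathbb{Z}G$. It is $(\sigma,\tau)$-inner if there is $x\in\mathbb{Z}G$ such that $\delta(a)=x\tau(a)-\sigma(a)x$ for all $a\in\mathbb{Z}G$. *)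

theory Defs
  imports "HOL-Library.Poly_Mapping" "HOL-Algebra.Ring"
begin

(* The product of the type ('g \<Rightarrow>\<^sub>0 int) cannot be used here: it convolves along
   the addition of the type 'g, whereas here the group operation is that of the record G. *)
definition group_ring :: "('g, 'm) monoid_scheme \<Rightarrow> ('g \<Rightarrow>\<^sub>0 int) ring" where
  "group_ring G =
    \<lparr>carrier = {a. Poly_Mapping.keys a \<subseteq> carrier G},
     mult = (\<lambda>a b. \<Sum>g\<in>Poly_Mapping.keys a. \<Sum>h\<in>Poly_Mapping.keys b.
        Poly_Mapping.single (g \<otimes>\<^bsub>G\<^esub> h) (Poly_Mapping.lookup a g * Poly_Mapping.lookup b h)),
     one = Poly_Mapping.single \<one>\<^bsub>G\<^esub> 1,
     zero = 0,
     add = (+)\<rparr>"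

definition ring_center :: "('a, 'm) ring_scheme \<Rightarrow> 'a set" where
  "ring_center R = {z \<in> carrier R. \<forall>a\<in>carrier R. z \<otimes>\<^bsub>R\<^esub> a = a \<otimes>\<^bsub>R\<^esub> z}"

definition Z_linear :: "('a, 'm) ring_scheme \<Rightarrow> ('a \<Rightarrow> 'a) \<Rightarrow> bool" where
  "Z_linear R f \<longleftrightarrow>
     f \<in> carrier R \<rightarrow> carrier R \<and>
     (\<forall>a\<in>carrier R. \<forall>b\<in>carrier R. f (a \<oplus>\<^bsub>R\<^esub> b) = f a \<oplus>\<^bsub>R\<^esub> f b) \<and>
     (\<forall>k::int. \<forall>a\<in>carrier R. f ([k] \<cdot>\<^bsub>R\<^esub> a) = [k] \<cdot>\<^bsub>R\<^esub> f a)"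

(* \<open>frag_of g\<close> is the group element g, seen as an element of the group ring. *)
definition linear_extension ::
  "('g, 'm) monoid_scheme \<Rightarrow> ('g \<Rightarrow> 'g) \<Rightarrow> (('g \<Rightarrow>\<^sub>0 int) \<Rightarrow> ('g \<Rightarrow>\<^sub>0 int)) \<Rightarrow> bool" where
  "linear_extension G \<phi> \<sigma> \<longleftrightarrow>
     Z_linear (group_ring G) \<sigma> \<and> (\<forall>g\<in>carrier G. \<sigma> (frag_of g) = frag_of (\<phi> g))"

(* Meant for ring endomorphisms \<sigma> and \<tau> of R; in the group ring, linear extensions of group
   endomorphisms are such, by \<open>linear_extension_ring_hom\<close> below. *)
definition twisted_derivation ::
  "('a, 'm) ring_scheme \<Rightarrow> ('a \<Rightarrow> 'a) \<Rightarrow> ('a \<Rightarrow> 'a) \<Rightarrow> ('a \<Rightarrow> 'a) \<Rightarrow> bool" where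
  "twisted_derivation R \<sigma> \<tau> \<delta> \<longleftrightarrow>
     Z_linear R \<delta> \<and>
     (\<forall>a\<in>carrier R. \<forall>b\<in>carrier R.
        \<delta> (a \<otimes>\<^bsub>R\<^esub> b) = \<delta> a \<otimes>\<^bsub>R\<^esub> \<tau> b \<oplus>\<^bsub>R\<^esub> \<sigma> a \<otimes>\<^bsub>R\<^esub> \<delta> b)"

definition twisted_inner ::
  "('a, 'm) ring_scheme \<Rightarrow> ('a \<Rightarrow> 'a) \<Rightarrow> ('a \<Rightarrow> 'a) \<Rightarrow> ('a \<Rightarrow> 'a) \<Rightarrow> bool" where
  "twisted_inner R \<sigma> \<tau> \<delta> \<longleftrightarrow>
     (\<exists>x\<in>carrier R. \<forall>a\<in>carrier R. \<delta> a = x \<otimes>\<^bsub>R\<^esub> \<tau> a \<ominus>\<^bsub>R\<^esub> \<sigma> a \<otimes>\<^bsub>R\<^esub> x)"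

lemma group_ring_simps:
  "a \<in> carrier (group_ring G) \<longleftrightarrow> Poly_Mapping.keys a \<subseteq> carrier G"
  "\<zero>\<^bsub>group_ring G\<^esub> = 0"
  "\<one>\<^bsub>group_ring G\<^esub> = frag_of \<one>\<^bsub>G\<^esub>"
  "a \<oplus>\<^bsub>group_ring G\<^esub> b = a + b"
  by (simp_all add: group_ring_def)

lemma group_ring_mult:
  "a \<otimes>\<^bsub>group_ring G\<^esub> b = frag_extend (\<lambda>g. frag_extend (\<lambda>h. frag_of (g \<otimes>\<^bsub>G\<^esub> h)) b) a"
proof -
  have *: "Poly_Mapping.single g (m * n) = frag_cmul m (frag_cmul n (frag_of g))"
    for g :: 'a and m n :: int
    by (rule poly_mapping_eqI) (simp add: lookup_single when_def)
  show ?thesis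
    unfolding group_ring_def frag_extend_def by (simp add: * frag_cmul_sum)
qed

lemma group_ring_mult_of:
  "frag_of g \<otimes>\<^bsub>group_ring G\<^esub> frag_of h = frag_of (g \<otimes>\<^bsub>G\<^esub> h)"
  by (simp add: group_ring_mult)

lemma group_ring_diff_mult:
  "(a - b) \<otimes>\<^bsub>group_ring G\<^esub> c = a \<otimes>\<^bsub>group_ring G\<^esub> c - b \<otimes>\<^bsub>group_ring G\<^esub> c"
  by (simp add: group_ring_mult frag_extend_diff)

lemma group_ring_add_mult:
  "(a + b) \<otimes>\<^bsub>group_ring G\<^esub> c = a \<otimes>\<^bsub>group_ring G\<^esub> c + b \<otimes>\<^bsub>group_ring G\<^esub> c"
  by (simp add: group_ring_mult frag_extend_add)

lemma group_ring_mult_add: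
  "c \<otimes>\<^bsub>group_ring G\<^esub> (a + b) = c \<otimes>\<^bsub>group_ring G\<^esub> a + c \<otimes>\<^bsub>group_ring G\<^esub> b"
  by (simp add: group_ring_mult frag_extend_add)
    (simp add: frag_extend_def sum.distrib frag_cmul_distrib2)

lemma group_ring_mult_diff:
  "c \<otimes>\<^bsub>group_ring G\<^esub> (a - b) = c \<otimes>\<^bsub>group_ring G\<^esub> a - c \<otimes>\<^bsub>group_ring G\<^esub> b"
  using group_ring_mult_add[where c=c and a="a - b" and b=b and G=G] by simp

lemma group_ring_mult_zero:
  "0 \<otimes>\<^bsub>group_ring G\<^esub> a = 0" "a \<otimes>\<^bsub>group_ring G\<^esub> 0 = 0"
  by (simp_all add: group_ring_mult frag_extend_eq_0)

lemma (in Group.group) ring_group_ring: "ring (group_ring G)"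
proof (rule ringI)
  show "abelian_group (group_ring G)"
  proof (rule abelian_groupI)
    fix x y assume "x \<in> carrier (group_ring G)" "y \<in> carrier (group_ring G)"
    then show "x \<oplus>\<^bsub>group_ring G\<^esub> y \<in> carrier (group_ring G)"
      using Poly_Mapping.keys_add[of x y] by (auto simp: group_ring_simps)
  next
    fix x assume "x \<in> carrier (group_ring G)"
    then show "\<exists>y\<in>carrier (group_ring G). y \<oplus>\<^bsub>group_ring G\<^esub> x = \<zero>\<^bsub>group_ring G\<^esub>"
      by (intro bexI[of _ "- x"]) (auto simp: group_ring_simps)
  qed (auto simp: group_ring_simps)
  show "Group.monoid (group_ring G)"
  proof
    fix x y assume xy: "x \<in> carrier (group_ring G)" "y \<in> carrier (group_ring G)"
    have "Poly_Mapping.keys (frag_extend (\<lambda>h. frag_of (g \<otimes> h)) y) \<subseteq> carrier G"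
      if "g \<in> carrier G" for g
      using xy that by (intro order_trans[OF keys_frag_extend]) (auto simp: group_ring_simps)
    then show "x \<otimes>\<^bsub>group_ring G\<^esub> y \<in> carrier (group_ring G)"
      using xy unfolding group_ring_mult group_ring_simps
      by (intro order_trans[OF keys_frag_extend]) blast
  next
    fix x y z
    assume x: "x \<in> carrier (group_ring G)" and y: "y \<in> carrier (group_ring G)"
      and z: "z \<in> carrier (group_ring G)"
    let ?P = "\<lambda>x y z. x \<otimes>\<^bsub>group_ring G\<^esub> y \<otimes>\<^bsub>group_ring G\<^esub> z
                     = x \<otimes>\<^bsub>group_ring G\<^esub> (y \<otimes>\<^bsub>group_ring G\<^esub> z)"
    have 1: "?P (frag_of g) (frag_of h) z" if "g \<in> carrier G" "h \<in> carrier G" for g h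
      using z[unfolded group_ring_simps]
      by (induction z rule: frag_induction)
        (auto simp: group_ring_mult_zero group_ring_mult_of group_ring_mult_diff m_assoc that)
    have 2: "?P (frag_of g) y z" if "g \<in> carrier G" for g
      using y[unfolded group_ring_simps]
      by (induction y rule: frag_induction)
        (auto simp: group_ring_mult_zero group_ring_mult_diff group_ring_diff_mult 1 that)
    show "?P x y z"
      using x[unfolded group_ring_simps]
      by (induction x rule: frag_induction)
        (auto simp: group_ring_mult_zero group_ring_diff_mult 2)
  next
    fix x assume x: "x \<in> carrier (group_ring G)"
    show "\<one>\<^bsub>group_ring G\<^esub> \<otimes>\<^bsub>group_ring G\<^esub> x = x"
      using x[unfolded group_ring_simps(1)] unfolding group_ring_simps
      by (induction x rule: frag_induction)
        (auto simp: group_ring_mult_zero group_ring_mult_of group_ring_mult_diff)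
    show "x \<otimes>\<^bsub>group_ring G\<^esub> \<one>\<^bsub>group_ring G\<^esub> = x"
      using x[unfolded group_ring_simps(1)] unfolding group_ring_simps
      by (induction x rule: frag_induction)
        (auto simp: group_ring_mult_zero group_ring_mult_of group_ring_diff_mult)
  qed (auto simp: group_ring_simps)
qed (auto simp: group_ring_simps group_ring_add_mult group_ring_mult_add)

lemma (in Group.group) linear_extension_ring_hom:
  assumes "\<phi> \<in> hom G G" and "linear_extension G \<phi> \<sigma>"
  shows "\<sigma> \<in> ring_hom (group_ring G) (group_ring G)"
proof (rule ring_hom_memI)
  interpret R: ring "group_ring G" by (rule ring_group_ring)
  have clo: "\<sigma> a \<in> carrier (group_ring G)" if "a \<in> carrier (group_ring G)" for a
    using assms that by (auto simp: linear_extension_def Z_linear_def)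
  have add: "\<sigma> (a + b) = \<sigma> a + \<sigma> b"
    if "a \<in> carrier (group_ring G)" "b \<in> carrier (group_ring G)" for a b
    using assms that by (auto simp: linear_extension_def Z_linear_def group_ring_simps)
  have of: "\<sigma> (frag_of g) = frag_of (\<phi> g)" if "g \<in> carrier G" for g
    using assms that by (auto simp: linear_extension_def)
  have zero: "\<sigma> 0 = 0"
    using add[of 0 0] by (simp add: group_ring_simps)
  have ca: "Poly_Mapping.keys (a - b) \<subseteq> carrier G"
    if "Poly_Mapping.keys a \<subseteq> carrier G" "Poly_Mapping.keys b \<subseteq> carrier G"
    for a b :: "'a \<Rightarrow>\<^sub>0 int"
    using that keys_diff[of a b] by blast
  have diff: "\<sigma> (a - b) = \<sigma> a - \<sigma> b"
    if "a \<in> carrier (group_ring G)" "b \<in> carrier (group_ring G)" for a b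
    using add[of "a - b" b] ca[of a b] that by (simp add: group_ring_simps)
  have ext: "\<sigma> a = frag_extend (frag_of \<circ> \<phi>) a" if "a \<in> carrier (group_ring G)" for a
  proof -
    have "Poly_Mapping.keys a \<subseteq> carrier G \<and> \<sigma> a = frag_extend (frag_of \<circ> \<phi>) a"
      using that[unfolded group_ring_simps]
      by (induction a rule: frag_induction)
        (auto simp: zero of diff ca group_ring_simps frag_extend_diff dest: subsetD[OF keys_diff])
    then show ?thesis by simp
  qed
  show "\<sigma> x \<in> carrier (group_ring G)" if "x \<in> carrier (group_ring G)" for x
    by (rule clo[OF that])
  show "\<sigma> (x \<oplus>\<^bsub>group_ring G\<^esub> y) = \<sigma> x \<oplus>\<^bsub>group_ring G\<^esub> \<sigma> y"
    if "x \<in> carrier (group_ring G)" "y \<in> carrier (group_ring G)" for x y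
    using add[OF that] by (simp add: group_ring_simps)
  show "\<sigma> \<one>\<^bsub>group_ring G\<^esub> = \<one>\<^bsub>group_ring G\<^esub>"
    using hom_one[OF assms(1)] of by (simp add: group_ring_simps)
  let ?e = "frag_extend (frag_of \<circ> \<phi>)"
  have e1: "?e (frag_of g \<otimes>\<^bsub>group_ring G\<^esub> y) = ?e (frag_of g) \<otimes>\<^bsub>group_ring G\<^esub> ?e y"
    if g: "g \<in> carrier G" and y: "Poly_Mapping.keys y \<subseteq> carrier G" for g y
    using y
    by (induction y rule: frag_induction)
      (auto simp: group_ring_mult_zero group_ring_mult_of group_ring_mult_diff frag_extend_diff
        g hom_mult[OF assms(1)])
  have e2: "?e (x \<otimes>\<^bsub>group_ring G\<^esub> y) = ?e x \<otimes>\<^bsub>group_ring G\<^esub> ?e y"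
    if x: "Poly_Mapping.keys x \<subseteq> carrier G" and y: "Poly_Mapping.keys y \<subseteq> carrier G" for x y
    using x
  proof (induction x rule: frag_induction)
    case (one g)
    then show ?case by (rule e1[OF _ y])
  qed (simp_all add: group_ring_mult_zero group_ring_diff_mult frag_extend_diff)
  show "\<sigma> (x \<otimes>\<^bsub>group_ring G\<^esub> y) = \<sigma> x \<otimes>\<^bsub>group_ring G\<^esub> \<sigma> y"
    if "x \<in> carrier (group_ring G)" "y \<in> carrier (group_ring G)" for x y
    using e2[of x y] that ext R.m_closed by (simp add: group_ring_simps(1))
qed

end

theory Submission
  imports Defs
begin

text \<open>
  On group elements, \<open>g \<mapsto> \<delta> g \<cdot> (\<psi> g)\<inverse>\<close> is a 1-cocycle for the action
  \<open>g \<bullet> a = \<phi> g \<cdot> a \<cdot> (\<psi> g)\<inverse>\<close>, which permutes the basis of the group ring. Averaging it gives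
  \<open>y\<close> with \<open>n \<delta> g = y \<cdot> \<psi> g - \<phi> g \<cdot> y\<close>, where \<open>n\<close> is the group order. Hence modulo \<open>n\<close> the
  coefficients of \<open>y\<close> are constant on orbits, and the coefficientwise integer quotient of \<open>y\<close>
  by \<open>n\<close> already implements \<open>\<delta>\<close>.
\<close>

lemma group_ring_sum_mult:
  "(\<Sum>i\<in>I. f i) \<otimes>\<^bsub>group_ring G\<^esub> c = (\<Sum>i\<in>I. f i \<otimes>\<^bsub>group_ring G\<^esub> c)"
  by (induction I rule: infinite_finite_induct)
    (simp_all add: group_ring_mult_zero group_ring_add_mult)

lemma group_ring_mult_sum:
  "c \<otimes>\<^bsub>group_ring G\<^esub> (\<Sum>i\<in>I. f i) = (\<Sum>i\<in>I. c \<otimes>\<^bsub>group_ring G\<^esub> f i)"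
  by (induction I rule: infinite_finite_induct)
    (simp_all add: group_ring_mult_zero group_ring_mult_add)

lemma group_ring_sum_closed:
  assumes "\<And>i. i \<in> I \<Longrightarrow> f i \<in> carrier (group_ring G)"
  shows "(\<Sum>i\<in>I. f i) \<in> carrier (group_ring G)"
  using assms unfolding group_ring_simps by (intro order_trans[OF keys_sum]) auto

text \<open>In the record, subtraction goes through the inverse of the additive group. Uniqueness of
  inverses identifies it with the subtraction of the type, in which all calculations are
  done.\<close>

lemma (in Group.group) group_ring_minus:
  assumes "a \<in> carrier (group_ring G)" "b \<in> carrier (group_ring G)"
  shows "a \<ominus>\<^bsub>group_ring G\<^esub> b = a - b"
proof -
  interpret R: ring "group_ring G" by (rule ring_group_ring)
  have "\<ominus>\<^bsub>group_ring G\<^esub> b = - b"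
    by (rule R.minus_equality) (use assms in \<open>auto simp: group_ring_simps\<close>)
  then show ?thesis
    by (simp add: a_minus_def group_ring_simps)
qed

text \<open>Right multiplication by \<open>g\<close> permutes the basis, since
  \<open>h \<otimes> g = k\<close> has the unique solution \<open>h = k \<otimes> inv g\<close>. So
  this product, like its mirror image below, only moves coefficients and thus commutes with
  operations applied to each coefficient.\<close>

lemma (in Group.group) lookup_mult_frag_of:
  assumes "a \<in> carrier (group_ring G)" "g \<in> carrier G" "k \<in> carrier G"
  shows "Poly_Mapping.lookup (a \<otimes>\<^bsub>group_ring G\<^esub> frag_of g) k = Poly_Mapping.lookup a (k \<otimes> inv g)"
  using assms(1)[unfolded group_ring_simps]
proof (induction a rule: frag_induction)
  case (one h)
  then have "h \<otimes> g = k \<longleftrightarrow> h = k \<otimes> inv g"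
    using assms by (auto simp: m_assoc)
  then show ?case
    by (auto simp: group_ring_mult_of lookup_single when_def)
qed (simp_all add: group_ring_mult_zero group_ring_diff_mult lookup_minus)

lemma (in Group.group) lookup_frag_of_mult:
  assumes "a \<in> carrier (group_ring G)" "g \<in> carrier G" "k \<in> carrier G"
  shows "Poly_Mapping.lookup (frag_of g \<otimes>\<^bsub>group_ring G\<^esub> a) k = Poly_Mapping.lookup a (inv g \<otimes> k)"
  using assms(1)[unfolded group_ring_simps]
proof (induction a rule: frag_induction)
  case (one h)
  then have "g \<otimes> h = k \<longleftrightarrow> h = inv g \<otimes> k"
    using assms by (auto simp: m_assoc[symmetric])
  then show ?case
    by (auto simp: group_ring_mult_of lookup_single when_def)
qed (simp_all add: group_ring_mult_zero group_ring_mult_diff lookup_minus)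

text \<open>This form of additivity fits \<open>frag_induction\<close>, which builds elements from
  group elements by differences.\<close>

lemma Z_linear_group_ring_diff:
  assumes "Z_linear (group_ring G) f"
    and "a \<in> carrier (group_ring G)" "b \<in> carrier (group_ring G)"
  shows "f (a - b) = f a - f b"
proof -
  have "a - b \<in> carrier (group_ring G)"
    using assms(2,3) keys_diff[of a b] by (auto simp: group_ring_simps)
  then have "f (a - b + b) = f (a - b) + f b"
    using assms unfolding Z_linear_def group_ring_simps(4) by blast
  then show ?thesis by simp
qed

text \<open>Both sides of the inner formula are additive in the argument, and the group elements
  generate the group ring additively.\<close>

lemma (in Group.group) twisted_inner_if_on_group:
  assumes "Z_linear (group_ring G) \<sigma>" "Z_linear (group_ring G) \<tau>" "Z_linear (group_ring G) \<delta>"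
    and x: "x \<in> carrier (group_ring G)"
    and on_group: "\<And>g. g \<in> carrier G \<Longrightarrow> \<delta> (frag_of g) =
      x \<otimes>\<^bsub>group_ring G\<^esub> \<tau> (frag_of g) - \<sigma> (frag_of g) \<otimes>\<^bsub>group_ring G\<^esub> x"
  shows "twisted_inner (group_ring G) \<sigma> \<tau> \<delta>"
  unfolding twisted_inner_def
proof (intro bexI[OF _ x] ballI)
  interpret R: ring "group_ring G" by (rule ring_group_ring)
  fix a assume a: "a \<in> carrier (group_ring G)"
  have f_zero: "f 0 = 0" if "Z_linear (group_ring G) f" for f
    using Z_linear_group_ring_diff[OF that, of 0 0] by (simp add: group_ring_simps)
  \<comment> \<open>Membership is part of the claim because the difference case of the induction
    supplies nothing about \<open>a\<close> and \<open>b\<close> beyond the claim itself.\<close>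
  have "a \<in> carrier (group_ring G) \<and>
    \<delta> a = x \<otimes>\<^bsub>group_ring G\<^esub> \<tau> a - \<sigma> a \<otimes>\<^bsub>group_ring G\<^esub> x"
    using a[unfolded group_ring_simps]
  proof (induction a rule: frag_induction)
    case zero
    then show ?case
      using assms(1-3) by (simp add: f_zero group_ring_mult_zero group_ring_simps)
  next
    case (one g)
    then show ?case by (simp add: on_group group_ring_simps)
  next
    case (diff a b)
    then have "a - b \<in> carrier (group_ring G)"
      using keys_diff[of a b] by (auto simp: group_ring_simps)
    then show ?case
      using diff assms(1-3)
      by (simp add: Z_linear_group_ring_diff group_ring_mult_diff group_ring_diff_mult)
  qed
  moreover have "\<sigma> a \<in> carrier (group_ring G)" "\<tau> a \<in> carrier (group_ring G)"
    using assms(1,2) a by (auto simp: Z_linear_def)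
  ultimately show "\<delta> a = x \<otimes>\<^bsub>group_ring G\<^esub> \<tau> a \<ominus>\<^bsub>group_ring G\<^esub> \<sigma> a \<otimes>\<^bsub>group_ring G\<^esub> x"
    using x by (simp add: group_ring_minus)
qed

text \<open>Write \<open>c h\<close> for the summand of \<open>y\<close>. The twisted Leibniz rule
  says that \<open>c (g \<otimes> h)\<close> times \<open>\<psi> g\<close> is
  \<open>\<delta> g\<close> plus \<open>\<phi> g\<close> times \<open>c h\<close>. Summing over
  \<open>h\<close> gives the identity, as translation by \<open>g\<close> does not change the sum of
  \<open>c\<close>.\<close>

lemma (in Group.group) twisted_derivation_average:
  fixes \<sigma> \<tau> \<delta> :: "('a \<Rightarrow>\<^sub>0 int) \<Rightarrow> ('a \<Rightarrow>\<^sub>0 int)"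
  defines "R \<equiv> group_ring G"
  assumes "\<phi> \<in> hom G G" "linear_extension G \<phi> \<sigma>" "\<psi> \<in> hom G G" "linear_extension G \<psi> \<tau>"
    and \<delta>: "twisted_derivation R \<sigma> \<tau> \<delta>" and g: "g \<in> carrier G"
  defines "y \<equiv> \<Sum>h\<in>carrier G. \<delta> (frag_of h) \<otimes>\<^bsub>R\<^esub> frag_of (inv (\<psi> h))"
  shows "y \<otimes>\<^bsub>R\<^esub> frag_of (\<psi> g) = (\<Sum>h\<in>carrier G. \<delta> (frag_of g)) + frag_of (\<phi> g) \<otimes>\<^bsub>R\<^esub> y"
proof -
  interpret R: ring R unfolding R_def by (rule ring_group_ring)
  interpret \<psi>: group_hom G G \<psi>
    using assms(4) by unfold_locales
  have \<phi>_closed: "\<phi> h \<in> carrier G" if "h \<in> carrier G" for h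
    using assms(2) that by (auto simp: hom_def)
  have of_closed: "frag_of h \<in> carrier R" if "h \<in> carrier G" for h
    using that by (simp add: R_def group_ring_simps)
  have \<delta>_closed: "\<delta> (frag_of h) \<in> carrier R" if "h \<in> carrier G" for h
    using \<delta> of_closed[OF that] by (auto simp: twisted_derivation_def Z_linear_def)
  note closed = of_closed \<delta>_closed \<phi>_closed
  have of_mult: "frag_of h \<otimes>\<^bsub>R\<^esub> frag_of k = frag_of (h \<otimes> k)" for h k
    by (simp add: R_def group_ring_mult_of)
  \<comment> \<open>These translations make the ring laws of \<open>R\<close> applicable to
    expressions written with the addition of the type.\<close>
  have of_one: "frag_of \<one> = \<one>\<^bsub>R\<^esub>" and add: "(+) = (\<oplus>\<^bsub>R\<^esub>)"
    by (simp_all add: R_def group_ring_def)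
  have \<delta>_mult: "\<delta> (frag_of (g \<otimes> h)) =
      \<delta> (frag_of g) \<otimes>\<^bsub>R\<^esub> frag_of (\<psi> h) + frag_of (\<phi> g) \<otimes>\<^bsub>R\<^esub> \<delta> (frag_of h)"
    if "h \<in> carrier G" for h
  proof -
    have "\<tau> (frag_of h) = frag_of (\<psi> h)" "\<sigma> (frag_of g) = frag_of (\<phi> g)"
      using assms(3,5) that g by (auto simp: linear_extension_def)
    then show ?thesis
      using \<delta> of_closed[OF g] of_closed[OF that]
      by (auto simp: twisted_derivation_def of_mult[symmetric] add)
  qed
  have "y = (\<Sum>h\<in>carrier G. \<delta> (frag_of (g \<otimes> h)) \<otimes>\<^bsub>R\<^esub> frag_of (inv (\<psi> (g \<otimes> h))))"
    unfolding y_def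
    by (rule sum.reindex_bij_witness[of _ "\<lambda>h. g \<otimes> h" "\<lambda>h. inv g \<otimes> h"])
      (use g in \<open>auto simp: m_assoc[symmetric]\<close>)
  then have "y \<otimes>\<^bsub>R\<^esub> frag_of (\<psi> g) =
      (\<Sum>h\<in>carrier G. \<delta> (frag_of (g \<otimes> h)) \<otimes>\<^bsub>R\<^esub> frag_of (inv (\<psi> (g \<otimes> h))) \<otimes>\<^bsub>R\<^esub> frag_of (\<psi> g))"
    by (simp add: R_def group_ring_sum_mult)
  also have "\<dots> = (\<Sum>h\<in>carrier G. \<delta> (frag_of g) +
      frag_of (\<phi> g) \<otimes>\<^bsub>R\<^esub> (\<delta> (frag_of h) \<otimes>\<^bsub>R\<^esub> frag_of (inv (\<psi> h))))"
  proof (rule sum.cong[OF refl])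
    fix h assume h: "h \<in> carrier G"
    \<comment> \<open>The inverse of \<open>\<psi> (g \<otimes> h)\<close> ends in
      \<open>inv (\<psi> g)\<close>, which cancels against \<open>\<psi> g\<close>.\<close>
    have "\<delta> (frag_of (g \<otimes> h)) \<otimes>\<^bsub>R\<^esub> frag_of (inv (\<psi> (g \<otimes> h))) \<otimes>\<^bsub>R\<^esub> frag_of (\<psi> g)
      = \<delta> (frag_of (g \<otimes> h)) \<otimes>\<^bsub>R\<^esub> frag_of (inv (\<psi> h))"
      using g h closed
      by (simp add: R.m_assoc of_mult inv_mult_group m_assoc)
    also have "\<dots> = \<delta> (frag_of g) +
        frag_of (\<phi> g) \<otimes>\<^bsub>R\<^esub> (\<delta> (frag_of h) \<otimes>\<^bsub>R\<^esub> frag_of (inv (\<psi> h)))"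
      using g h closed
      by (simp add: \<delta>_mult add R.l_distr R.m_assoc of_mult of_one)
    finally show "\<delta> (frag_of (g \<otimes> h)) \<otimes>\<^bsub>R\<^esub> frag_of (inv (\<psi> (g \<otimes> h))) \<otimes>\<^bsub>R\<^esub> frag_of (\<psi> g) =
      \<delta> (frag_of g) + frag_of (\<phi> g) \<otimes>\<^bsub>R\<^esub> (\<delta> (frag_of h) \<otimes>\<^bsub>R\<^esub> frag_of (inv (\<psi> h)))" .
  qed
  also have "\<dots> = (\<Sum>h\<in>carrier G. \<delta> (frag_of g)) + frag_of (\<phi> g) \<otimes>\<^bsub>R\<^esub> y"
    by (simp add: sum.distrib y_def R_def group_ring_mult_sum)
  finally show ?thesis .
qed

theorem corollary4p1:
  fixes G :: "('g, 'm) monoid_scheme"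
    and \<phi> \<psi> :: "'g \<Rightarrow> 'g"
    and \<sigma> \<tau> \<delta> :: "('g \<Rightarrow>\<^sub>0 int) \<Rightarrow> ('g \<Rightarrow>\<^sub>0 int)"
  assumes "Group.group G" and "finite (carrier G)"
    and "\<phi> \<in> hom G G" and "linear_extension G \<phi> \<sigma>"
    and "\<psi> \<in> hom G G" and "linear_extension G \<psi> \<tau>"
    and "\<forall>z\<in>ring_center (group_ring G). \<sigma> z = z"
    and "\<forall>z\<in>ring_center (group_ring G). \<tau> z = z"
    and "twisted_derivation (group_ring G) \<sigma> \<tau> \<delta>"
  shows "twisted_inner (group_ring G) \<sigma> \<tau> \<delta>"
proof -
  interpret Group.group G by (rule assms(1))
  interpret R: ring "group_ring G" by (rule ring_group_ring)
  interpret \<phi>: group_hom G G \<phi>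
    using assms(3) by unfold_locales
  interpret \<psi>: group_hom G G \<psi>
    using assms(5) by unfold_locales
  have lin: "Z_linear (group_ring G) \<sigma>" "Z_linear (group_ring G) \<tau>" "Z_linear (group_ring G) \<delta>"
    using assms(4,6,9) by (auto simp: linear_extension_def twisted_derivation_def)
  have of_closed: "frag_of h \<in> carrier (group_ring G)" if "h \<in> carrier G" for h
    using that by (simp add: group_ring_simps)
  have \<delta>_closed: "\<delta> (frag_of h) \<in> carrier (group_ring G)" if "h \<in> carrier G" for h
    using lin(3) of_closed[OF that] by (auto simp: Z_linear_def)
  define n where "n = int (card (carrier G))"
  define y where "y = (\<Sum>h\<in>carrier G. \<delta> (frag_of h) \<otimes>\<^bsub>group_ring G\<^esub> frag_of (inv\<^bsub>G\<^esub> (\<psi> h)))"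
  \<comment> \<open>Let \<open>r\<close> be \<open>y\<close> minus \<open>n\<close> times
    \<open>x\<close>, the element of remainders modulo \<open>n\<close>. Averaging will show that
    \<open>r\<close> times \<open>\<psi> g\<close> equals \<open>\<phi> g\<close> times
    \<open>r\<close>, so dropping \<open>r\<close> from \<open>y\<close> does not affect the inner
    derivation, and the factor \<open>n\<close> can be cancelled.\<close>
  define x where "x = Poly_Mapping.map (\<lambda>c. c div n) y"
  have "n > 0"
    using assms(2) by (auto simp: n_def card_gt_0_iff)
  have y: "y \<in> carrier (group_ring G)"
    unfolding y_def by (intro group_ring_sum_closed R.m_closed \<delta>_closed of_closed) auto
  \<comment> \<open>\<open>Poly_Mapping.map\<close> acts on nonzero coefficients only; the formula
    holds everywhere because \<open>0 div n = 0\<close>.\<close>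
  have lookup_x: "Poly_Mapping.lookup x k = Poly_Mapping.lookup y k div n" for k
    by (simp add: x_def map.rep_eq when_def)
  have x: "x \<in> carrier (group_ring G)"
    using y by (fastforce simp: group_ring_simps in_keys_iff lookup_x)
  show ?thesis
  proof (rule twisted_inner_if_on_group[OF lin x])
    fix g assume g: "g \<in> carrier G"
    have \<sigma>\<tau>: "\<sigma> (frag_of g) = frag_of (\<phi> g)" "\<tau> (frag_of g) = frag_of (\<psi> g)"
      using assms(4,6) g by (auto simp: linear_extension_def)
    let ?r = "x \<otimes>\<^bsub>group_ring G\<^esub> frag_of (\<psi> g) - frag_of (\<phi> g) \<otimes>\<^bsub>group_ring G\<^esub> x"
    have "\<delta> (frag_of g) = ?r"
    proof (rule poly_mapping_eqI)
      fix k
      show "Poly_Mapping.lookup (\<delta> (frag_of g)) k = Poly_Mapping.lookup ?r k"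
      proof (cases "k \<in> carrier G")
        case True
        let ?a = "Poly_Mapping.lookup y (k \<otimes>\<^bsub>G\<^esub> inv\<^bsub>G\<^esub> (\<psi> g))"
        let ?b = "Poly_Mapping.lookup y (inv\<^bsub>G\<^esub> (\<phi> g) \<otimes>\<^bsub>G\<^esub> k)"
        let ?d = "Poly_Mapping.lookup (\<delta> (frag_of g)) k"
        \<comment> \<open>This is the averaging identity read at the coefficient of
          \<open>k\<close>; its constant sum contributes \<open>n\<close> copies of
          \<open>?d\<close>.\<close>
        have "?a = n * ?d + ?b"
          using arg_cong[OF twisted_derivation_average[OF assms(3-6,9) g, folded y_def],
              of "\<lambda>a. Poly_Mapping.lookup a k"] True g y
          by (simp add: lookup_mult_frag_of lookup_frag_of_mult lookup_add lookup_sum n_def)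
        \<comment> \<open>\<open>?a\<close> and \<open>?b\<close> leave the same remainder modulo
          \<open>n\<close>, so the difference of their rounded quotients is exact.\<close>
        then have "?d = ?a div n - ?b div n"
          using \<open>n > 0\<close> by simp
        then show ?thesis
          using True g x
          by (simp add: lookup_minus lookup_mult_frag_of lookup_frag_of_mult lookup_x)
      next
        case False
        \<comment> \<open>The coefficient formulas cover only \<open>k\<close> in the group;
          elsewhere both sides vanish by their supports.\<close>
        have "Poly_Mapping.lookup a k = 0" if "a \<in> carrier (group_ring G)" for a
          using that False by (auto simp: group_ring_simps in_keys_iff)
        moreover have "x \<otimes>\<^bsub>group_ring G\<^esub> frag_of (\<psi> g) \<in> carrier (group_ring G)"
          "frag_of (\<phi> g) \<otimes>\<^bsub>group_ring G\<^esub> x \<in> carrier (group_ring G)"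
          using x g by (auto intro!: of_closed)
        ultimately show ?thesis
          using \<delta>_closed[OF g] by (simp add: lookup_minus)
      qed
    qed
    then show "\<delta> (frag_of g) = x \<otimes>\<^bsub>group_ring G\<^esub> \<tau> (frag_of g)
        - \<sigma> (frag_of g) \<otimes>\<^bsub>group_ring G\<^esub> x"
      by (simp add: \<sigma>\<tau>)
  qed
qed

end
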